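(* Let $\mathcal{S}h: B_{n-1}\backslash\mathcal{B}_n\to W\times W$ be the map sending a $B_{n-1}$-orbit $Q$ on $\mathcal{B}_n$ to $\mathcal{S}h(Q):=(w,u^* )$, where $w,u^*\in W$ are the unique elements with $B\cdot Q=B\cdot w(\mathcal{E}_+)$ and $B^*\cdot Q=B^*\cdot u^*(\mathcal{E}^* )$. Then $\mathcal{S}h$ is injective. Further, if $\mathcal{S}h(Q)=(w,u^* )$, then $Q=B\cdot w(\mathcal{E}_+)\cap B^*\cdot u^*(\mathcal{E}^* )$, and the image of $\mathcal{S}h$ consists of all pairs $(w,u^* )\in W\times W$ such that $B\cdot w(\mathcal{E}_+)\cap B^*\cdot u^*(\mathcal{E}^* )$ is nonempty.
   Context: Let $n\ge 2$, $G=GL(n,\mathbb{C})$, and let $\mathcal{B}_n$ be the variety of full flags in $\mathbb{C}^n$ with its natural $G$-action. Let $e_1,\dots,e_n$ be the standard basis; $(v_1\subset v_2\subset\dots\subset v_n)$ denotes the full flag whose $i$-th subspace is $\mathrm{span}\{v_1,\dots,v_i\}$. Embed $GL(n-1,\mathbb{C})$ in $G$ in the top left corner, $x\mapsto \mathrm{diag}(x,1)$, and let $B_{n-1}$ be the upper triangular Borel subgroup of $GL(n-1,\mathbb{C})$, viewed as a subgroup of $G$. It acts on $\mathcal{B}_n$ with finitely many orbits; $B_{n-1}\backslash\mathcal{B}_n$ is the set of orbits. Put $\mathcal{E}_+=(e_1\subset e_2\subset\dots\subset e_n)$ and $\mathcal{E}^*=(e_n\subset e_1\subset e_2\subset\dots\subset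 e_{n-1})$, with stabilizers $B$ (the upper triangular matrices) and $B^*$ in $G$, respectively. The Weyl group $W=\mathcal{S}_n$ acts by $w(e_i)=e_{w(i)}$, and hence acts on the flags spanned by permutations of the standard basis. By the Bruhat decomposition each $B$-orbit on $\mathcal{B}_n$ is $B\cdot w(\mathcal{E}_+)$ for a unique $w\in W$, and each $B^*$-orbit is $B^*\cdot u^*(\mathcal{E}^* )$ for a unique $u^*\in W$. *)

theory Defs
  imports "HOL-Analysis.Analysis" "HOL-Combinatorics.Permutations"
begin

text \<open>
  The indices 1, ..., n are the elements, in increasing order, of a finite linearly ordered
  type \<open>'n\<close> with n = \<open>CARD('n)\<close>. Spans, subspaces and dimensions are the complex ones, i.e.
  those of the interpretation \<open>vec\<close>; the unqualified versions are over the reals.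
\<close>

type_synonym 'n cvec = "(complex, 'n) vec"
type_synonym 'n cmat = "((complex, 'n) vec, 'n) vec"
type_synonym 'n chain = "'n \<Rightarrow> (complex, 'n) vec set"

definition GL :: "'n::finite cmat set" where
  "GL = {g. invertible g}"

definition last_index :: "'n::{finite,linorder}" where
  "last_index = Max UNIV"

definition std_e :: "'n::finite \<Rightarrow> 'n cvec" where
  "std_e i = axis i 1"

text \<open>A full flag is given by its subspaces \<open>F i\<close>; the required dimension \<open>card {..i}\<close> is the
  position of \<open>i\<close> in \<open>'n\<close>.\<close>

definition flags :: "'n::{finite,linorder} chain set" where
  "flags = {F. (\<forall>i. vec.subspace (F i) \<and> vec.dim (F i) = card {..i}) \<and>
               (\<forall>i j. i \<le> j \<longrightarrow> F i \<subseteq> F j)}"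

definition act :: "'n::finite cmat \<Rightarrow> 'n chain \<Rightarrow> 'n chain" where
  "act g F = (\<lambda>i. (\<lambda>x. g *v x) ` F i)"

definition translates :: "'n::finite cmat set \<Rightarrow> 'n chain set \<Rightarrow> 'n chain set" where
  "translates H S = {act g F | g F. g \<in> H \<and> F \<in> S}"

abbreviation orbit :: "'n::finite cmat set \<Rightarrow> 'n chain \<Rightarrow> 'n chain set" where
  "orbit H F \<equiv> translates H {F}"

definition flag_orbits :: "'n::{finite,linorder} cmat set \<Rightarrow> 'n chain set set" where
  "flag_orbits H = orbit H ` flags"

definition stabilizer :: "'n::finite chain \<Rightarrow> 'n cmat set" where
  "stabilizer F = {g \<in> GL. act g F = F}"

definition E_plus :: "'n::{finite,linorder} chain" where
  "E_plus i = vec.span (std_e ` {..i})"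

text \<open>The flag \<open>(e\<^sub>n \<subset> e\<^sub>1 \<subset> \<dots> \<subset> e\<^sub>n\<^sub>-\<^sub>1)\<close>: its i-th subspace is spanned by the first i of
  these vectors, that is, by \<open>e\<^sub>n\<close> and the \<open>e\<^sub>j\<close> with j < i.\<close>

definition E_star :: "'n::{finite,linorder} chain" where
  "E_star i = vec.span (insert (std_e last_index) (std_e ` {..<i}))"

definition Borel :: "'n::{finite,linorder} cmat set" where
  "Borel = stabilizer E_plus"

definition Borel_star :: "'n::{finite,linorder} cmat set" where
  "Borel_star = stabilizer E_star"

definition upper_triangular :: "'n::{finite,linorder} cmat \<Rightarrow> bool" where
  "upper_triangular g \<longleftrightarrow> (\<forall>i j. j < i \<longrightarrow> g $ i $ j = 0)"

text \<open>The copy of GL(n - 1) in GL(n): the matrices diag(x, 1) with \<open>x\<close> of size n - 1.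
  Such a matrix is invertible if and only if \<open>x\<close> is.\<close>

definition GL_pred :: "'n::{finite,linorder} cmat set" where
  "GL_pred = {g \<in> GL. g $ last_index $ last_index = 1 \<and>
     (\<forall>i. i \<noteq> last_index \<longrightarrow> g $ i $ last_index = 0 \<and> g $ last_index $ i = 0)}"

definition Borel_pred :: "'n::{finite,linorder} cmat set" where
  "Borel_pred = {g \<in> GL_pred. upper_triangular g}"

definition Weyl :: "('n \<Rightarrow> 'n) set" where
  "Weyl = {w. w permutes UNIV}"

definition perm_matrix :: "('n \<Rightarrow> 'n) \<Rightarrow> 'n::finite cmat" where
  "perm_matrix w = (\<chi> i j. if i = w j then 1 else 0)"

abbreviation weyl_act :: "('n \<Rightarrow> 'n) \<Rightarrow> 'n::finite chain \<Rightarrow> 'n chain" where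
  "weyl_act w F \<equiv> act (perm_matrix w) F"

text \<open>Both components are well defined by the Bruhat decomposition.\<close>

definition Sh :: "'n::{finite,linorder} chain set \<Rightarrow> ('n \<Rightarrow> 'n) \<times> ('n \<Rightarrow> 'n)" where
  "Sh Q = (THE w. w \<in> Weyl \<and> translates Borel Q = orbit Borel (weyl_act w E_plus),
           THE u. u \<in> Weyl \<and> translates Borel_star Q = orbit Borel_star (weyl_act u E_star))"

lemma mult_std_e: "(g *v std_e j) $ i = g $ i $ j"
  by (simp add: matrix_vector_mult_def std_e_def axis_def if_distrib[of "\<lambda>x. _ * x"] cong: if_cong)

lemma perm_matrix_std_e: "perm_matrix w *v std_e i = std_e (w i)"
  by (simp add: vec_eq_iff mult_std_e) (simp add: perm_matrix_def std_e_def axis_def)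

lemma le_last_index: "i \<le> last_index"
  by (simp add: last_index_def)

lemma inj_std_e: "inj std_e"
  by (simp add: inj_def std_e_def axis_eq_axis)

lemma span_std_e: "vec.span (std_e ` I) = {x. \<forall>i. i \<notin> I \<longrightarrow> x $ i = 0}"
proof
  have "vec.subspace {x :: 'a cvec. \<forall>i. i \<notin> I \<longrightarrow> x $ i = 0}"
    by (auto simp: vec.subspace_def)
  then show "vec.span (std_e ` I) \<subseteq> {x. \<forall>i. i \<notin> I \<longrightarrow> x $ i = 0}"
    by (intro vec.span_minimal) (auto simp: std_e_def axis_def)
next
  show "{x. \<forall>i. i \<notin> I \<longrightarrow> x $ i = 0} \<subseteq> vec.span (std_e ` I)"
  proof
    fix x :: "'a cvec" assume x: "x \<in> {x. \<forall>i. i \<notin> I \<longrightarrow> x $ i = 0}"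
    have "x = (\<Sum>i\<in>UNIV. x $ i *s std_e i)"
      by (simp add: vec_eq_iff std_e_def axis_def if_distrib cong: if_cong)
    also have "\<dots> = (\<Sum>i\<in>I. x $ i *s std_e i)"
      using x by (intro sum.mono_neutral_right) auto
    also have "\<dots> \<in> vec.span (std_e ` I)"
      by (intro vec.span_sum vec.span_scale vec.span_base) auto
    finally show "x \<in> vec.span (std_e ` I)" .
  qed
qed

lemma dim_span_std_e: "vec.dim (vec.span (std_e ` I)) = card I"
proof -
  have "std_e ` I \<subseteq> (cart_basis :: 'a cvec set)"
    by (auto simp: cart_basis_def std_e_def)
  then have "vec.independent (std_e ` I :: 'a cvec set)"
    using vec.independent_Basis vec.independent_mono by blast
  then have "vec.dim (vec.span (std_e ` I :: 'a cvec set)) = card (std_e ` I :: 'a cvec set)"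
    by (simp add: vec.dim_eq_card_independent)
  also have "\<dots> = card I"
    by (rule card_image[OF inj_on_subset[OF inj_std_e]]) simp
  finally show ?thesis .
qed

lemma E_plus_in_flags: "E_plus \<in> flags"
proof -
  have "E_plus i \<subseteq> E_plus j" if "i \<le> j" for i j :: 'a
    unfolding E_plus_def using that by (intro vec.span_mono) auto
  then show ?thesis
    using dim_span_std_e by (auto simp: flags_def E_plus_def)
qed

lemma E_star_in_flags: "E_star \<in> flags"
proof -
  have "vec.dim (E_star i) = card {..i}" for i :: 'a
  proof -
    have "last_index \<notin> {..<i}"
      using le_last_index[of i] by auto
    then have "card (insert last_index {..<i}) = card (insert i {..<i})"
      by simp
    also have "insert i {..<i} = {..i}"
      by auto
    finally show ?thesis
      using dim_span_std_e[of "insert last_index {..<i}"] by (simp add: E_star_def)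
  qed
  moreover have "E_star i \<subseteq> E_star j" if "i \<le> j" for i j :: 'a
    unfolding E_star_def using that by (intro vec.span_mono) auto
  ultimately show ?thesis
    by (auto simp: flags_def E_star_def)
qed

lemma Borel_eq: "Borel = {g \<in> GL. upper_triangular g}"
proof (intro set_eqI iffI)
  fix g :: "'a cmat" assume "g \<in> Borel"
  then have g: "g \<in> GL" and s: "\<And>i. (*v) g ` E_plus i = E_plus i"
    by (auto simp: Borel_def stabilizer_def act_def fun_eq_iff)
  have "g $ i $ j = 0" if "j < i" for i j
  proof -
    have "std_e j \<in> E_plus j"
      unfolding E_plus_def by (rule vec.span_base) auto
    then have "g *v std_e j \<in> E_plus j"
      using s[of j] by blast
    then have "(g *v std_e j) $ i = 0"
      using that by (auto simp: E_plus_def span_std_e)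
    then show ?thesis
      by (simp add: mult_std_e)
  qed
  then show "g \<in> {g \<in> GL. upper_triangular g}"
    using g by (auto simp: upper_triangular_def)
next
  fix g :: "'a cmat" assume "g \<in> {g \<in> GL. upper_triangular g}"
  then have g: "invertible g" and u: "\<And>i j. j < i \<Longrightarrow> g $ i $ j = 0"
    by (auto simp: upper_triangular_def GL_def)
  have "(*v) g ` E_plus i = E_plus i" for i
  proof (rule vec.subspace_dim_equal)
    show "vec.subspace ((*v) g ` E_plus i)"
      using matrix_vector_mul_linear_gen[of g] vec.linear_subspace_image
      by (auto simp: E_plus_def)
    show "vec.subspace (E_plus i)"
      by (simp add: E_plus_def)
    show "(*v) g ` E_plus i \<subseteq> E_plus i"
    proof clarify
      fix x assume "x \<in> E_plus i"
      then have x: "\<And>k. i < k \<Longrightarrow> x $ k = 0"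
        by (auto simp: E_plus_def span_std_e)
      have "g $ j $ k * x $ k = 0" if "i < j" for j k
        using that u[of k j] x[of k] by (cases "k < j") auto
      then show "g *v x \<in> E_plus i"
        by (auto simp: E_plus_def span_std_e matrix_vector_mult_def intro!: sum.neutral)
    qed
    have "inj ((*v) g)"
      using g by (auto simp: invertible_def matrix_left_invertible_injective[symmetric])
    then have "inj_on ((*v) g) (vec.span (E_plus i))"
      by (rule inj_on_subset) simp
    then show "vec.dim (E_plus i) \<le> vec.dim ((*v) g ` E_plus i)"
      using vec.dim_image_eq[OF matrix_vector_mul_linear_gen[of g]] by fastforce
  qed
  then show "g \<in> Borel"
    using g by (auto simp: Borel_def stabilizer_def act_def GL_def)
qed

end

theory Submission
  imports Defs
begin

text \<open>
  Write \<open>e\<close> for the last standard basis vector and \<open>E\<^sub>k\<close> for the subspaces of the standard flag, so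
  that the subspaces of the flag \<open>E_star\<close> are \<open>\<complex>e + E\<^sub>k\<^sub>-\<^sub>1\<close>. An invertible upper triangular matrix that fixes
  \<open>e\<close> lies in \<open>Borel_pred\<close>. All three assertions therefore follow from the Bruhat decompositions for
  \<open>Borel\<close> and \<open>Borel_star\<close> and from one fact (\<open>Borel_pred_transitive\<close>): if \<open>F' = b F = d F\<close> with
  \<open>b\<close> in \<open>Borel\<close> and \<open>d\<close> in \<open>Borel_star\<close>, then some such matrix also
  carries \<open>F\<close> to \<open>F'\<close>.

  To see this, note that \<open>e \<in> E\<^sub>k\<^sub>-\<^sub>1 + F\<^sub>j\<close> holds if and only if \<open>F\<^sub>j\<close> meets \<open>\<complex>e + E\<^sub>k\<^sub>-\<^sub>1\<close> in a
  larger space than it meets \<open>E\<^sub>k\<^sub>-\<^sub>1\<close> (\<open>in_sum_last_iff_dim\<close>). The first of these two dimensions is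
  preserved by \<open>d\<close>, the second by \<open>b\<close>, so the condition holds for \<open>F\<close> if and only if it holds for
  \<open>F'\<close>; equivalently, for \<open>F\<close> it holds for \<open>e\<close> if and only if it holds for \<open>b\<inverse> e\<close>. Now choose
  coordinates in which the standard flag stays the same and \<open>F\<close> is \<open>w\<close> applied to it. In these
  coordinates \<open>e\<close> and \<open>b\<inverse> e\<close> become vectors \<open>l\<close> and \<open>m\<close>, and the condition on a vector says that
  every index \<open>a\<close> of its support satisfies \<open>a < k\<close> or \<open>w\<inverse> a \<le> j\<close>. Hence these conditions, over all
  \<open>j\<close> and \<open>k\<close>, determine the down-set that the support generates in the partial order
  ``\<open>i \<le> i'\<close> and \<open>w\<inverse> i \<le> w\<inverse> i'\<close>'' (\<open>support_dominated\<close>). The common stabilizer of the two flags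
  consists of the invertible matrices supported on this order, and it acts transitively on the vectors
  with a given down-set (\<open>triangular_transport\<close>). So it contains a matrix carrying \<open>l\<close> to \<open>m\<close>;
  composed with \<open>b\<close>, this matrix fixes \<open>e\<close> and still carries \<open>F\<close> to \<open>F'\<close>.
\<close>

section \<open>The action on flags\<close>

lemma act_mult: "act (g ** h) F = act g (act h F)"
  by (simp add: act_def image_image matrix_vector_mul_assoc)

lemma act_one [simp]: "act (mat 1) F = F"
  by (simp add: act_def)

lemma GL_inverse:
  assumes "g \<in> GL"
  obtains h where "h \<in> GL" "g ** h = mat 1" "h ** g = mat 1"
  using assms by (auto simp: GL_def invertible_def)

lemma GL_mult: "g \<in> GL \<Longrightarrow> h \<in> GL \<Longrightarrow> g ** h \<in> GL"
  by (simp add: GL_def invertible_mult)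

lemma GL_inj: "g \<in> GL \<Longrightarrow> inj ((*v) g)"
  by (auto simp: GL_def invertible_def matrix_left_invertible_injective[symmetric])

lemma GL_if_inj:
  fixes g :: "'n::finite cmat"
  assumes "\<And>x. g *v x = 0 \<Longrightarrow> x = 0"
  shows "g \<in> GL"
proof -
  have "inj ((*v) g)"
    using assms by (metis matrix_left_invertible_injective matrix_left_invertible_ker)
  then show ?thesis
    by (simp add: GL_def invertible_left_inverse matrix_left_invertible_injective)
qed

lemma dim_act:
  assumes "g \<in> GL"
  shows "vec.dim ((*v) g ` S) = vec.dim S"
  by (rule vec.dim_image_eq[OF matrix_vector_mul_linear_gen])
     (rule inj_on_subset[OF GL_inj[OF assms] subset_UNIV])

lemma act_in_flags:
  assumes "g \<in> GL" "F \<in> flags"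
  shows "act g F \<in> flags"
proof -
  have "vec.subspace ((*v) g ` F i)" for i
    using assms vec.linear_subspace_image[OF matrix_vector_mul_linear_gen] by (auto simp: flags_def)
  moreover have "(*v) g ` F i \<subseteq> (*v) g ` F j" if "i \<le> j" for i j
    using assms that by (intro image_mono) (auto simp: flags_def)
  ultimately show ?thesis
    using assms by (auto simp: flags_def act_def dim_act)
qed

text \<open>Inclusions suffice because corresponding subspaces of two flags have equal dimensions.\<close>

lemma act_eqI:
  assumes "g \<in> GL" "F \<in> flags" "F' \<in> flags"
    and "\<And>j x. x \<in> F j \<Longrightarrow> g *v x \<in> F' j"
  shows "act g F = F'"
proof
  fix j
  have "act g F \<in> flags"
    using assms act_in_flags by blast
  then show "act g F j = F' j"
    using assms by (intro vec.subspace_dim_equal) (auto simp: flags_def act_def)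
qed

lemma mem_act_iff:
  assumes "g \<in> GL"
  shows "g *v x \<in> act g F j \<longleftrightarrow> x \<in> F j"
  using GL_inj[OF assms] by (auto simp: act_def inj_image_mem_iff)

lemma stabilizer_one: "mat 1 \<in> stabilizer F"
  by (simp add: stabilizer_def GL_def invertible_def)

lemma stabilizer_mult: "g \<in> stabilizer F \<Longrightarrow> h \<in> stabilizer F \<Longrightarrow> g ** h \<in> stabilizer F"
  by (simp add: stabilizer_def act_mult GL_mult)

lemma stabilizer_inverse:
  assumes "g \<in> stabilizer F"
  obtains h where "h \<in> stabilizer F" "g ** h = mat 1" "h ** g = mat 1"
proof -
  obtain h where h: "h \<in> GL" "g ** h = mat 1" "h ** g = mat 1"
    using assms GL_inverse by (auto simp: stabilizer_def)
  have "act h F = act (h ** g) F"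
    using assms by (simp add: act_mult stabilizer_def)
  then have "h \<in> stabilizer F"
    using h by (simp add: stabilizer_def)
  then show ?thesis using h that by blast
qed

lemma mem_orbit_iff: "F \<in> orbit H X \<longleftrightarrow> (\<exists>g\<in>H. F = act g X)"
  by (auto simp: translates_def)

lemma mem_orbit_trans:
  "F \<in> orbit (stabilizer E) X \<Longrightarrow> X \<in> orbit (stabilizer E) Y \<Longrightarrow> F \<in> orbit (stabilizer E) Y"
  unfolding mem_orbit_iff by (metis act_mult stabilizer_mult)

lemma mem_orbit_sym:
  "F \<in> orbit (stabilizer E) X \<Longrightarrow> X \<in> orbit (stabilizer E) F"
  unfolding mem_orbit_iff by (metis act_mult act_one stabilizer_inverse)

lemma translates_orbit:
  assumes "K \<subseteq> stabilizer E" "mat 1 \<in> K"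
  shows "translates (stabilizer E) (orbit K F) = orbit (stabilizer E) F"
proof
  show "translates (stabilizer E) (orbit K F) \<subseteq> orbit (stabilizer E) F"
    using assms by (auto simp: translates_def) (metis act_mult stabilizer_mult subsetD)
  have "F \<in> orbit K F"
    using assms by (metis act_one mem_orbit_iff)
  then show "orbit (stabilizer E) F \<subseteq> translates (stabilizer E) (orbit K F)"
    by (auto simp: translates_def)
qed

text \<open>Turns the defining conditions of \<open>Sh\<close>, which compare sets of flags, into the membership of one
  representative; \<open>K\<close> will be \<open>Borel_pred\<close>.\<close>

lemma translates_orbit_eq_iff:
  assumes "K \<subseteq> stabilizer E" "mat 1 \<in> K"
  shows "translates (stabilizer E) (orbit K F) = orbit (stabilizer E) X \<longleftrightarrow> F \<in> orbit (stabilizer E) X"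
proof -
  have "F \<in> orbit (stabilizer E) F"
    by (metis act_one mem_orbit_iff stabilizer_one)
  then show ?thesis
    unfolding translates_orbit[OF assms] using mem_orbit_trans mem_orbit_sym by blast
qed

section \<open>Permutation matrices and coordinate flags\<close>

lemma perm_matrix_mult: "perm_matrix v ** perm_matrix w = perm_matrix (v \<circ> w)"
proof -
  have "(perm_matrix v ** perm_matrix w) $ i $ j = perm_matrix (v \<circ> w) $ i $ j" for i j
    by (simp add: mult_std_e[symmetric] matrix_vector_mul_assoc[symmetric] perm_matrix_std_e)
  then show ?thesis by (simp add: vec_eq_iff)
qed

lemma perm_matrix_id: "perm_matrix id = mat 1"
  by (simp add: perm_matrix_def mat_def vec_eq_iff)

lemma weyl_act_comp: "weyl_act (v \<circ> w) F = weyl_act v (weyl_act w F)"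
  by (simp add: act_mult[symmetric] perm_matrix_mult)

lemma Weyl_bij: "w \<in> Weyl \<longleftrightarrow> bij w"
  by (auto simp: Weyl_def permutes_bij intro: bij_imp_permutes)

lemma perm_matrix_inverse:
  assumes "w \<in> Weyl"
  shows "perm_matrix w ** perm_matrix (inv w) = mat 1" "perm_matrix (inv w) ** perm_matrix w = mat 1"
  using assms
  by (auto simp: perm_matrix_mult perm_matrix_id[symmetric] Weyl_bij bij_is_inj bij_is_surj
      surj_iff[symmetric] inj_iff[symmetric] surj_iff[THEN iffD1] inj_iff[THEN iffD1])

lemma perm_matrix_in_GL: "w \<in> Weyl \<Longrightarrow> perm_matrix w \<in> GL"
  unfolding GL_def invertible_def using perm_matrix_inverse by blast

lemma weyl_act_span:
  "(*v) (perm_matrix w) ` vec.span (std_e ` I) = vec.span (std_e ` (w ` I))"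
proof -
  have "(*v) (perm_matrix w) ` vec.span (std_e ` I) = vec.span ((*v) (perm_matrix w) ` (std_e ` I))"
    by (rule vec.linear_span_image[OF matrix_vector_mul_linear_gen, symmetric])
  then show ?thesis
    by (simp add: image_image perm_matrix_std_e)
qed

lemma mem_weyl_act_E_plus:
  assumes "w \<in> Weyl"
  shows "x \<in> weyl_act w E_plus j \<longleftrightarrow> (\<forall>k. x $ k \<noteq> 0 \<longrightarrow> inv w k \<le> j)"
proof -
  have "k \<in> w ` {..j} \<longleftrightarrow> inv w k \<le> j" for k
    using bij_image_Collect_eq[of w "\<lambda>m. m \<le> j"] assms by (simp add: Weyl_bij atMost_def)
  moreover have "weyl_act w E_plus j = vec.span (std_e ` (w ` {..j}))"
    by (simp only: act_def E_plus_def weyl_act_span)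
  ultimately show ?thesis
    by (auto simp: span_std_e)
qed

lemma weyl_act_in_flags: "w \<in> Weyl \<Longrightarrow> E \<in> flags \<Longrightarrow> weyl_act w E \<in> flags"
  by (simp add: act_in_flags perm_matrix_in_GL)

section \<open>Pivots and the Bruhat decomposition\<close>

definition pivot :: "'n::{finite,linorder} cvec \<Rightarrow> 'n \<Rightarrow> bool" where
  "pivot x i \<longleftrightarrow> x $ i \<noteq> 0 \<and> (\<forall>k>i. x $ k = 0)"

lemma pivot_exists:
  assumes "x \<noteq> 0"
  obtains i where "pivot x i"
proof -
  let ?S = "{i. x $ i \<noteq> 0}"
  have ne: "?S \<noteq> {}" using assms by (auto simp: vec_eq_iff)
  have "Max ?S \<in> ?S" using ne by (intro Max_in) auto
  moreover have "x $ k = 0" if "k > Max ?S" for k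
  proof (rule ccontr)
    assume "x $ k \<noteq> 0"
    then have "k \<le> Max ?S" by (intro Max_ge) auto
    with that show False by simp
  qed
  ultimately show ?thesis using that[of "Max ?S"] unfolding pivot_def by blast
qed

lemma mem_E_plus: "x \<in> E_plus i \<longleftrightarrow> (\<forall>k>i. x $ k = 0)"
  by (simp add: E_plus_def span_std_e not_le)

lemma pivot_iff_E_plus:
  "pivot x i \<longleftrightarrow> x \<noteq> 0 \<and> x \<in> E_plus i \<and> (\<forall>m<i. x \<notin> E_plus m)"
proof
  assume "pivot x i"
  then show "x \<noteq> 0 \<and> x \<in> E_plus i \<and> (\<forall>m<i. x \<notin> E_plus m)"
    by (auto simp: pivot_def mem_E_plus)
next
  assume x: "x \<noteq> 0 \<and> x \<in> E_plus i \<and> (\<forall>m<i. x \<notin> E_plus m)"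
  then obtain m where m: "pivot x m" using pivot_exists by blast
  then have "\<not> m < i" "\<not> i < m" using x by (auto simp: pivot_def mem_E_plus)
  with m show "pivot x i" by (metis linorder_neqE)
qed

text \<open>Pivots are intrinsic to the standard flag, which \<open>b\<close> preserves.\<close>

lemma pivot_Borel:
  assumes "b \<in> Borel"
  shows "pivot (b *v x) i \<longleftrightarrow> pivot x i"
proof -
  have b: "b \<in> GL" "act b E_plus = E_plus" using assms by (auto simp: Borel_def stabilizer_def)
  have "b *v x \<in> E_plus m \<longleftrightarrow> x \<in> E_plus m" for m
    using mem_act_iff[OF b(1), of x E_plus m] b(2) by simp
  moreover have "b *v x = 0 \<longleftrightarrow> x = 0"
    using GL_inj[OF b(1)] by (metis injD matrix_vector_mult_0_right)
  ultimately show ?thesis by (simp add: pivot_iff_E_plus)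
qed

text \<open>The hypothesis says that \<open>g\<close> is upper triangular with nonzero diagonal. A nonzero \<open>x\<close> with pivot
  \<open>i\<close> is not in the kernel because the \<open>i\<close>-th entry of \<open>g x\<close> is \<open>g\<^sub>i\<^sub>i x\<^sub>i\<close>.\<close>

lemma triangular_in_Borel:
  assumes "\<And>i. pivot (g *v std_e i) i"
  shows "g \<in> Borel"
proof -
  have ut: "upper_triangular g" and d: "\<And>i. g $ i $ i \<noteq> 0"
    using assms by (auto simp: pivot_def upper_triangular_def mult_std_e)
  have "x = 0" if x: "g *v x = 0" for x
  proof (rule ccontr)
    assume "x \<noteq> 0"
    then obtain i where i: "pivot x i" using pivot_exists by blast
    have "(g *v x) $ i = (\<Sum>j\<in>UNIV. g $ i $ j * x $ j)"
      by (simp add: matrix_vector_mult_def)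
    also have "\<dots> = (\<Sum>j\<in>{i}. g $ i $ j * x $ j)"
      using ut i by (intro sum.mono_neutral_right) (auto simp: upper_triangular_def pivot_def, metis linorder_neqE)
    finally show False using x d i by (simp add: pivot_def)
  qed
  then show ?thesis using ut by (simp add: Borel_eq GL_if_inj)
qed

lemma flag_step:
  assumes "F \<in> flags"
  obtains x where "x \<in> F j" "x \<noteq> 0" "\<And>m. m < j \<Longrightarrow> x \<notin> F m"
proof -
  have sub: "vec.subspace (F i)" and dim: "vec.dim (F i) = card {..i}" and mono: "i \<le> k \<Longrightarrow> F i \<subseteq> F k" for i k
    using assms by (auto simp: flags_def)
  show ?thesis
  proof (cases "{..<j} = {}")
    case True
    have "\<not> F j \<subseteq> {0}"
      using dim[of j] vec.dim_subset[of "F j" "{0}"] by (auto simp: card_eq_0_iff)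
    then obtain x where "x \<in> F j" "x \<noteq> 0" by blast
    moreover have "x \<notin> F m" if "m < j" for m using True that by blast
    ultimately show ?thesis using that by blast
  next
    case False
    define p where "p = Max {..<j}"
    have p: "p < j" "\<And>m. m < j \<Longrightarrow> m \<le> p"
      using False Max_in[of "{..<j}"] by (auto simp: p_def)
    have "card {..p} < card {..j}"
      using p(1) by (intro psubset_card_mono) (auto simp: psubset_eq)
    then have "\<not> F j \<subseteq> F p"
      using dim vec.dim_subset[of "F j" "F p"] by auto
    then obtain x where x: "x \<in> F j" "x \<notin> F p" by blast
    moreover have "x \<noteq> 0" using x sub vec.subspace_0 by blast
    moreover have "x \<notin> F m" if "m < j" for m
      using x p(2)[OF that] mono by blast
    ultimately show ?thesis using that by blast
  qed
qed

text \<open>Gaussian elimination along the flag: \<open>w j\<close> is the least pivot of a vector that lies in \<open>F j\<close> but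
  in no earlier subspace. A vector \<open>v j\<close> realizing it becomes the column \<open>w j\<close> of \<open>b\<close>; the pivots make
  \<open>b\<close> upper triangular, and \<open>w\<close> is a permutation because two vectors with the same pivot can be
  subtracted to lower the pivot of the later one.\<close>

lemma Bruhat_exists:
  fixes F :: "'n::{finite,linorder} chain"
  assumes "F \<in> flags"
  obtains w where "w \<in> Weyl" "F \<in> orbit Borel (weyl_act w E_plus)"
proof -
  have sub: "vec.subspace (F i)" and mono: "i \<le> k \<Longrightarrow> F i \<subseteq> F k" for i k
    using assms by (auto simp: flags_def)
  define new where "new j x \<longleftrightarrow> x \<in> F j \<and> x \<noteq> 0 \<and> (\<forall>m<j. x \<notin> F m)" for j x
  define P where "P j = {i. \<exists>x. new j x \<and> pivot x i}" for j
  define w where "w j = Min (P j)" for j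
  have "P j \<noteq> {}" for j
  proof -
    obtain x where "new j x"
      using flag_step[OF assms, of j] unfolding new_def by metis
    moreover then obtain i where "pivot x i"
      using pivot_exists by (auto simp: new_def)
    ultimately show ?thesis by (auto simp: P_def)
  qed
  then have "w j \<in> P j" for j unfolding w_def by (intro Min_in) auto
  then obtain v where v: "\<And>j. new j (v j)" "\<And>j. pivot (v j) (w j)"
    unfolding P_def by simp metis
  have least: "w j \<le> i" if "new j x" "pivot x i" for i j x
    unfolding w_def using that by (intro Min_le) (auto simp: P_def)
  have neq: "w j \<noteq> w k" if "j < k" for j k
  proof
    assume eq: "w j = w k"
    \<comment> \<open>Cancelling the common pivot of \<open>v k\<close> and \<open>v j\<close> contradicts the minimality of \<open>w k\<close>.\<close>
    let ?i = "w k"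
    define c where "c = v k $ ?i / v j $ ?i"
    define x where "x = v k - c *s v j"
    have vF: "v j \<in> F m" if "j \<le> m" for m
      using that v(1)[of j] mono by (auto simp: new_def)
    have xF: "x \<notin> F m" if "m < k" for m
    proof
      assume "x \<in> F m"
      then have "x \<in> F (max m j)" using mono[of m "max m j"] by auto
      then have "x + c *s v j \<in> F (max m j)"
        by (intro vec.subspace_add[OF sub] vec.subspace_scale[OF sub] vF) auto
      then have "v k \<in> F (max m j)" by (simp add: x_def)
      then show False using v(1)[of k] \<open>m < k\<close> \<open>j < k\<close> by (auto simp: new_def)
    qed
    have "x \<in> F k" unfolding x_def
      using v(1)[of k] vF[of k] \<open>j < k\<close>
      by (intro vec.subspace_diff[OF sub] vec.subspace_scale[OF sub]) (auto simp: new_def)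
    moreover have "x \<noteq> 0" using xF[of j] \<open>j < k\<close> vec.subspace_0[OF sub] by auto
    ultimately have "new k x" using xF by (simp add: new_def)
    obtain i where i: "pivot x i" using pivot_exists \<open>x \<noteq> 0\<close> by blast
    have "x $ m = 0" if "?i \<le> m" for m
      using that v(2)[of j] v(2)[of k] eq by (cases "m = ?i") (auto simp: x_def c_def pivot_def)
    then have "i < ?i" using i by (auto simp: pivot_def not_le[symmetric])
    then show False using least[OF \<open>new k x\<close> i] by simp
  qed
  then have "inj w" by (metis injI linorder_neqE)
  then have w: "w \<in> Weyl" by (simp add: Weyl_bij bij_def finite_UNIV_inj_surj)
  define b :: "'n cmat" where "b = (\<chi> i k. v (inv w k) $ i)"
  have be: "b *v std_e (w j) = v j" for j
    by (simp add: vec_eq_iff mult_std_e b_def \<open>inj w\<close>)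
  have "pivot (b *v std_e i) i" for i
    using be[of "inv w i"] v(2)[of "inv w i"] w by (simp add: Weyl_bij bij_is_surj surj_f_inv_f)
  then have bB: "b \<in> Borel" by (rule triangular_in_Borel)
  have "act b (weyl_act w E_plus) = F"
  proof (rule act_eqI)
    show "b \<in> GL" using bB by (simp add: Borel_eq)
    show "weyl_act w E_plus \<in> flags" using w by (simp add: weyl_act_in_flags E_plus_in_flags)
    show "b *v x \<in> F j" if "x \<in> weyl_act w E_plus j" for j x
    proof -
      have "b *v x = (\<Sum>k\<in>UNIV. x $ k *s v (inv w k))"
        by (simp add: vec_eq_iff matrix_vector_mult_def b_def mult.commute)
      moreover have "x $ k *s v (inv w k) \<in> F j" for k
        using that mem_weyl_act_E_plus[OF w, of x j] v(1)[of "inv w k"] mono[of "inv w k" j] sub[of j]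
        by (cases "x $ k = 0") (auto simp: new_def vec.subspace_0 intro!: vec.subspace_scale)
      ultimately show ?thesis by (simp add: vec.subspace_sum[OF sub])
    qed
  qed (use assms in auto)
  then have "F \<in> orbit Borel (weyl_act w E_plus)" using bB by (auto simp: mem_orbit_iff)
  then show ?thesis using that w by blast
qed

text \<open>The set of pivots of the \<open>j\<close>-th subspace is invariant under \<open>b\<close>, and for a coordinate flag it is
  \<open>w ` {..j}\<close>; these sets determine \<open>w\<close>.\<close>

lemma Bruhat_unique:
  assumes w: "w \<in> Weyl" and w': "w' \<in> Weyl" and b: "b \<in> Borel"
    and eq: "act b (weyl_act w E_plus) = weyl_act w' E_plus"
  shows "w = w'"
proof
  have pivots: "{i. \<exists>x\<in>weyl_act u E_plus j. pivot x i} = {i. inv u i \<le> j}" if "u \<in> Weyl" for u and j :: 'a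
  proof (intro set_eqI iffI; clarsimp)
    fix i assume "inv u i \<le> j"
    then have "std_e i \<in> weyl_act u E_plus j"
      using that by (auto simp: mem_weyl_act_E_plus std_e_def axis_def)
    moreover have "pivot (std_e i) i" by (auto simp: pivot_def std_e_def axis_def)
    ultimately show "\<exists>x\<in>weyl_act u E_plus j. pivot x i" by blast
  qed (use that in \<open>auto simp: mem_weyl_act_E_plus pivot_def\<close>)
  have "{i. \<exists>x\<in>weyl_act w' E_plus j. pivot x i} = {i. \<exists>x\<in>weyl_act w E_plus j. pivot x i}" for j
    unfolding eq[symmetric] act_def[of b] using pivot_Borel[OF b] by auto
  then have le: "inv w' i \<le> j \<longleftrightarrow> inv w i \<le> j" for i j
    using pivots[OF w, of j] pivots[OF w', of j] by (simp add: set_eq_iff)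
  have "inv w i = inv w' i" for i
    using le[of i] by (meson antisym order_refl)
  then show "w k = w' k" for k
    using w w' by (metis Weyl_bij bij_inv_eq_iff)
qed

lemma Bruhat: "F \<in> flags \<Longrightarrow> \<exists>!w. w \<in> Weyl \<and> F \<in> orbit Borel (weyl_act w E_plus)"
proof (rule ex_ex1I)
  assume "F \<in> flags"
  then show "\<exists>w. w \<in> Weyl \<and> F \<in> orbit Borel (weyl_act w E_plus)"
    using Bruhat_exists by metis
next
  fix w w' assume *: "w \<in> Weyl \<and> F \<in> orbit Borel (weyl_act w E_plus)" "w' \<in> Weyl \<and> F \<in> orbit Borel (weyl_act w' E_plus)"
  then have "weyl_act w' E_plus \<in> orbit Borel (weyl_act w E_plus)"
    using mem_orbit_sym mem_orbit_trans unfolding Borel_def by blast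
  then obtain b where "b \<in> Borel" "weyl_act w' E_plus = act b (weyl_act w E_plus)"
    unfolding mem_orbit_iff by blast
  then show "w = w'" using Bruhat_unique[OF _ _ _ sym] * by blast
qed

text \<open>The permutation is the cycle that sends the first index to the last one and every other index to
  its predecessor. Through it the Bruhat decomposition for \<open>Borel_star\<close> follows from that for \<open>Borel\<close>
  by conjugation.\<close>

lemma E_star_eq_weyl_act: "\<exists>s\<in>Weyl. E_star = weyl_act s (E_plus :: 'n::{finite,linorder} chain)"
proof -
  define s :: "'n \<Rightarrow> 'n" where "s i = (if {..<i} = {} then last_index else Max {..<i})" for i
  have s_less: "s i < i" "\<And>m. m < i \<Longrightarrow> m \<le> s i" if "{..<i} \<noteq> {}" for i
    using that Max_in[of "{..<i}"] by (auto simp: s_def)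
  have "s i \<noteq> s k" if "i < k" for i k
  proof (cases "{..<i} = {}")
    case True
    have "s k < k" using s_less(1)[of k] that by auto
    then have "s k \<noteq> last_index" using le_last_index[of k] by auto
    then show ?thesis using True by (simp add: s_def)
  next
    case False
    have "s i < i" using s_less(1)[OF False] .
    also have "i \<le> s k" using s_less(2)[of k i] that by auto
    finally show ?thesis by simp
  qed
  then have inj: "inj s" by (metis injI linorder_neqE)
  then have s: "s \<in> Weyl" by (simp add: Weyl_bij bij_def finite_UNIV_inj_surj)
  have "s ` {..i} = insert last_index {..<i}" for i
  proof (rule card_subset_eq)
    have "s k \<in> insert last_index {..<i}" if "k \<le> i" for k
      using s_less(1)[of k] that by (cases "{..<k} = {}") (auto simp: s_def)
    then show "s ` {..i} \<subseteq> insert last_index {..<i}" by auto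
    have "last_index \<notin> {..<i}" using le_last_index[of i] by auto
    then have "card (insert last_index {..<i}) = card (insert i {..<i})" by simp
    also have "insert i {..<i} = {..i}" by auto
    also have "card {..i} = card (s ` {..i})"
      using inj by (metis card_image inj_on_subset subset_UNIV)
    finally show "card (s ` {..i}) = card (insert last_index {..<i})" by simp
  qed simp
  then have "E_star = weyl_act s E_plus"
    by (simp add: act_def E_plus_def weyl_act_span fun_eq_iff E_star_def)
  with s show ?thesis by blast
qed

lemma stabilizer_conj:
  assumes "b \<in> stabilizer E" "g \<in> GL" "h ** g = mat 1" "g ** h = mat 1"
  shows "g ** b ** h \<in> stabilizer (act g E)"
proof -
  have "h \<in> GL" using assms by (auto simp: GL_def invertible_def)
  have "act (g ** b ** h) (act g E) = act g (act b (act (h ** g) E))"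
    by (simp only: act_mult)
  also have "\<dots> = act g E" using assms by (simp add: stabilizer_def)
  finally show ?thesis
    using assms \<open>h \<in> GL\<close> by (simp add: stabilizer_def GL_mult)
qed

lemma orbit_stabilizer_conj:
  assumes "g \<in> GL" "h \<in> GL" "h ** g = mat 1" "g ** h = mat 1"
  shows "act g F \<in> orbit (stabilizer (act g E)) (act g X) \<longleftrightarrow> F \<in> orbit (stabilizer E) X"
proof
  assume "F \<in> orbit (stabilizer E) X"
  then obtain b where b: "b \<in> stabilizer E" "F = act b X" unfolding mem_orbit_iff by blast
  have "act (g ** b ** h) (act g X) = act g (act b (act (h ** g) X))"
    by (simp only: act_mult)
  then have "act g F = act (g ** b ** h) (act g X)" using b assms by simp
  then show "act g F \<in> orbit (stabilizer (act g E)) (act g X)"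
    using stabilizer_conj[OF b(1) assms(1,3,4)] unfolding mem_orbit_iff by blast
next
  assume "act g F \<in> orbit (stabilizer (act g E)) (act g X)"
  then obtain b where b: "b \<in> stabilizer (act g E)" "act g F = act b (act g X)"
    unfolding mem_orbit_iff by blast
  have hg: "act h (act g Y) = Y" for Y :: "'a chain"
    using assms by (simp add: act_mult[symmetric])
  have "act (h ** b ** g) X = act h (act b (act g X))" by (simp only: act_mult)
  also have "\<dots> = F" using b hg by metis
  finally have "F = act (h ** b ** g) X" by simp
  moreover have "h ** b ** g \<in> stabilizer E"
    using stabilizer_conj[OF b(1) assms(2,4,3)] hg by simp
  ultimately show "F \<in> orbit (stabilizer E) X" unfolding mem_orbit_iff by blast
qed

text \<open>With \<open>E_star = s E_plus\<close>, the Weyl group element \<open>u\<close> of \<open>F\<close> for \<open>Borel_star\<close> corresponds to the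
  element \<open>s\<inverse> u s\<close> of \<open>s\<inverse> F\<close> for \<open>Borel\<close>.\<close>

lemma Bruhat_star:
  fixes F :: "'n::{finite,linorder} chain"
  assumes "F \<in> flags"
  shows "\<exists>!u. u \<in> Weyl \<and> F \<in> orbit Borel_star (weyl_act u E_star)"
proof -
  obtain s where s: "s \<in> Weyl" and E: "E_star = weyl_act s (E_plus :: 'n chain)"
    using E_star_eq_weyl_act by blast
  let ?g = "perm_matrix s :: 'n cmat" and ?h = "perm_matrix (inv s) :: 'n cmat"
  have s': "inv s \<in> Weyl" using s by (simp add: Weyl_bij bij_imp_bij_inv)
  note gh = perm_matrix_in_GL[OF s] perm_matrix_in_GL[OF s'] perm_matrix_inverse(2)[OF s] perm_matrix_inverse(1)[OF s]
  have [simp]: "act ?g (act ?h Y) = Y" for Y using gh by (simp add: act_mult[symmetric])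
  let ?c = "\<lambda>u. inv s \<circ> u \<circ> s"
  have key: "F \<in> orbit Borel_star (weyl_act u E_star) \<longleftrightarrow>
      weyl_act (inv s) F \<in> orbit Borel (weyl_act (?c u) E_plus)" for u
    using orbit_stabilizer_conj[OF gh, of "act ?h F" E_plus "weyl_act (?c u) E_plus"]
    by (simp add: Borel_star_def Borel_def E weyl_act_comp)
  have ex1: "\<exists>!w. w \<in> Weyl \<and> weyl_act (inv s) F \<in> orbit Borel (weyl_act w E_plus)"
    by (intro Bruhat weyl_act_in_flags s' assms)
  have cW: "?c u \<in> Weyl" if "u \<in> Weyl" for u
    using that s s' by (simp add: Weyl_bij bij_comp)
  have ss: "s (inv s i) = i" "inv s (s i) = i" for i
    using s by (auto simp: Weyl_bij bij_is_surj surj_f_inv_f bij_is_inj)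
  show ?thesis
  proof (rule ex_ex1I)
    obtain w where w: "w \<in> Weyl" "weyl_act (inv s) F \<in> orbit Borel (weyl_act w E_plus)"
      using ex1 by blast
    have "?c (s \<circ> w \<circ> inv s) = w" by (simp add: fun_eq_iff ss)
    then show "\<exists>u. u \<in> Weyl \<and> F \<in> orbit Borel_star (weyl_act u E_star)"
      using w s s' by (intro exI[of _ "s \<circ> w \<circ> inv s"]) (simp add: key Weyl_bij bij_comp)
  next
    fix u u' assume "u \<in> Weyl \<and> F \<in> orbit Borel_star (weyl_act u E_star)"
      "u' \<in> Weyl \<and> F \<in> orbit Borel_star (weyl_act u' E_star)"
    then have "?c u = ?c u'" using ex1 cW unfolding key by blast
    then have "s (?c u (inv s k)) = s (?c u' (inv s k))" for k by simp
    then show "u = u'" by (simp add: ss fun_eq_iff)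
  qed
qed

section \<open>Flags that share a Borel orbit and a \<open>Borel_star\<close> orbit\<close>

text \<open>In the partial order ``\<open>i \<le> i'\<close> and \<open>r i \<le> r i'\<close>'', the hypotheses say that the supports of \<open>l\<close> and
  \<open>l'\<close> generate the same down-set. An index \<open>i\<close> lying strictly below some \<open>t\<close> in the support of \<open>l\<close> can
  have its entry corrected by adding a multiple of \<open>l\<^sub>t\<close>. At every other index either both vectors
  vanish or neither does, so that rescaling suffices.\<close>

lemma triangular_transport:
  fixes r :: "'n::{finite,linorder} \<Rightarrow> 'n"
  assumes l: "\<And>a. l $ a \<noteq> 0 \<Longrightarrow> \<exists>a'. a \<le> a' \<and> r a \<le> r a' \<and> l' $ a' \<noteq> 0"
    and l': "\<And>a. l' $ a \<noteq> 0 \<Longrightarrow> \<exists>a'. a \<le> a' \<and> r a \<le> r a' \<and> l $ a' \<noteq> 0"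
  obtains c :: "'n cmat" where "c \<in> Borel" "c *v l = l'" "\<And>i j. c $ i $ j \<noteq> 0 \<Longrightarrow> r i \<le> r j"
proof -
  define above where "above i t \<longleftrightarrow> i < t \<and> r i \<le> r t \<and> l $ t \<noteq> 0" for i t
  define t where "t i = (SOME t. above i t)" for i
  define top where "top i \<longleftrightarrow> (\<forall>t. \<not> above i t)" for i
  have t: "above i (t i)" if "\<not> top i" for i
    using that unfolding t_def top_def by (metis someI)
  have top: "l' $ i \<noteq> 0 \<longleftrightarrow> l $ i \<noteq> 0" if "top i" for i
  proof
    assume "l' $ i \<noteq> 0"
    then show "l $ i \<noteq> 0" using l' that unfolding top_def above_def by (metis order_le_less)
  next
    assume "l $ i \<noteq> 0"
    then obtain a where a: "i \<le> a" "r i \<le> r a" "l' $ a \<noteq> 0" using l by blast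
    then obtain a' where a': "a \<le> a'" "r a \<le> r a'" "l $ a' \<noteq> 0" using l' by blast
    have "\<not> i < a'" using that a a' unfolding top_def above_def by (meson order_trans)
    then have "a = i" using a a' by auto
    with a show "l' $ i \<noteq> 0" by simp
  qed
  \<comment> \<open>The diagonal entry is 1 unless rescaling is needed; the only other nonzero entries correct row
    \<open>i\<close> in column \<open>t i\<close>.\<close>
  define c :: "'n cmat" where "c = (\<chi> i j.
    if j = i then (if top i \<and> l $ i \<noteq> 0 then l' $ i / l $ i else 1)
    else if \<not> top i \<and> j = t i then (l' $ i - l $ i) / l $ t i else 0)"
  have order: "i \<le> j \<and> r i \<le> r j" if "c $ i $ j \<noteq> 0" for i j
    using that t[of i] by (auto simp: c_def above_def split: if_splits)
  have diag: "c $ i $ i \<noteq> 0" for i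
    using top[of i] by (auto simp: c_def)
  have "pivot (c *v std_e i) i" for i
    using diag order by (auto simp: pivot_def mult_std_e) (meson not_le)
  then have "c \<in> Borel" by (rule triangular_in_Borel)
  moreover have "c *v l = l'"
  proof -
    have "(c *v l) $ i = l' $ i" for i
    proof (cases "top i")
      case True
      have "(c *v l) $ i = (\<Sum>j\<in>{i}. c $ i $ j * l $ j)"
        unfolding matrix_vector_mult_def vec_lambda_beta
        by (intro sum.mono_neutral_right) (auto simp: c_def True)
      then show ?thesis using top[OF True] True by (auto simp: c_def)
    next
      case False
      then have ti: "t i \<noteq> i" "l $ t i \<noteq> 0" using t[OF False] by (auto simp: above_def)
      have "(c *v l) $ i = (\<Sum>j\<in>{i, t i}. c $ i $ j * l $ j)"
        unfolding matrix_vector_mult_def vec_lambda_beta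
        by (intro sum.mono_neutral_right) (auto simp: c_def False)
      then show ?thesis using ti False by (auto simp: c_def)
    qed
    then show ?thesis by (simp add: vec_eq_iff)
  qed
  ultimately show ?thesis using that order by blast
qed

text \<open>The subspace just before \<open>E_plus k\<close>. It is the zero space for the first \<open>k\<close>, so that every
  subspace of \<open>E_star\<close> is the sum of the last coordinate line and an \<open>E_less k\<close>.\<close>

definition E_less :: "'n::{finite,linorder} \<Rightarrow> 'n cvec set" where
  "E_less k = {x. \<forall>i\<ge>k. x $ i = 0}"

lemma subspace_E_less: "vec.subspace (E_less k)"
  by (auto simp: vec.subspace_def E_less_def)

lemma Borel_E_less:
  assumes "b \<in> Borel" "x \<in> E_less k"
  shows "b *v x \<in> E_less k"
proof -
  have "b $ i $ j * x $ j = 0" if "k \<le> i" for i j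
    using that assms by (cases "j < i") (auto simp: Borel_eq upper_triangular_def E_less_def)
  then show ?thesis by (auto simp: E_less_def matrix_vector_mult_def intro!: sum.neutral)
qed

lemma Borel_image_E_less:
  assumes "b \<in> Borel"
  shows "(*v) b ` E_less k = E_less k"
proof
  show "(*v) b ` E_less k \<subseteq> E_less k" using Borel_E_less[OF assms] by blast
  obtain c where c: "c \<in> Borel" "b ** c = mat 1"
    using assms stabilizer_inverse unfolding Borel_def by metis
  show "E_less k \<subseteq> (*v) b ` E_less k"
  proof
    fix x assume "x \<in> E_less k"
    then have "c *v x \<in> E_less k" by (rule Borel_E_less[OF c(1)])
    moreover have "x = b *v (c *v x)" using c by (simp add: matrix_vector_mul_assoc)
    ultimately show "x \<in> (*v) b ` E_less k" by blast
  qed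
qed

text \<open>The condition \<open>y \<in> E_less k + S\<close>.\<close>

definition in_sum :: "'n::{finite,linorder} cvec \<Rightarrow> 'n \<Rightarrow> 'n cvec set \<Rightarrow> bool" where
  "in_sum y k S \<longleftrightarrow> (\<exists>x\<in>E_less k. y - x \<in> S)"

lemma in_sum_act:
  assumes "b \<in> Borel"
  shows "in_sum (b *v y) k (act b F j) \<longleftrightarrow> in_sum y k (F j)"
proof -
  have b: "b \<in> GL" using assms by (simp add: Borel_eq)
  have "in_sum (b *v y) k (act b F j) \<longleftrightarrow> (\<exists>x\<in>(*v) b ` E_less k. b *v y - x \<in> act b F j)"
    by (simp add: in_sum_def Borel_image_E_less[OF assms])
  also have "\<dots> \<longleftrightarrow> (\<exists>x\<in>E_less k. b *v (y - x) \<in> act b F j)"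
    by (simp add: matrix_vector_mult_diff_distrib)
  finally show ?thesis using mem_act_iff[OF b] by (simp add: in_sum_def)
qed

lemma in_sum_weyl_act:
  assumes "w \<in> Weyl"
  shows "in_sum y k (weyl_act w E_plus j) \<longleftrightarrow> (\<forall>a. y $ a \<noteq> 0 \<longrightarrow> a < k \<or> inv w a \<le> j)"
proof
  assume "in_sum y k (weyl_act w E_plus j)"
  then show "\<forall>a. y $ a \<noteq> 0 \<longrightarrow> a < k \<or> inv w a \<le> j"
    unfolding in_sum_def mem_weyl_act_E_plus[OF assms] E_less_def
    by clarsimp (metis diff_zero not_le)
next
  assume *: "\<forall>a. y $ a \<noteq> 0 \<longrightarrow> a < k \<or> inv w a \<le> j"
  show "in_sum y k (weyl_act w E_plus j)"
    unfolding in_sum_def mem_weyl_act_E_plus[OF assms] E_less_def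
    by (rule bexI[of _ "\<chi> a. if a < k then y $ a else 0"]) (use * in auto)
qed

lemma E_star_eq: "E_star k = {y. \<exists>c. y - c *s std_e last_index \<in> E_less k}"
proof (intro set_eqI iffI)
  fix y assume "y \<in> E_star k"
  then have "y - (y $ last_index) *s std_e last_index \<in> E_less k"
    unfolding E_star_def image_insert[symmetric] span_std_e
    by (auto simp: E_less_def std_e_def axis_def)
  then show "y \<in> {y. \<exists>c. y - c *s std_e last_index \<in> E_less k}" by blast
next
  fix y assume "y \<in> {y. \<exists>c. y - c *s std_e last_index \<in> E_less k}"
  then show "y \<in> E_star k"
    unfolding E_star_def image_insert[symmetric] span_std_e
    by (auto simp: E_less_def std_e_def axis_def not_less split: if_splits)
qed

text \<open>The last basis vector \<open>e\<close> is not in \<open>E_less k\<close>. Hence \<open>S\<close> meets \<open>E_star k\<close>, which is spanned by \<open>e\<close>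
  and \<open>E_less k\<close>, in more than it meets \<open>E_less k\<close> precisely when it contains a vector of
  \<open>e + E_less k\<close>. As a statement on dimensions, this can be transported by different group elements
  for the two intersections.\<close>

lemma in_sum_last_iff_dim:
  assumes S: "vec.subspace S"
  shows "in_sum (std_e last_index) k S \<longleftrightarrow> vec.dim (S \<inter> E_less k) \<noteq> vec.dim (S \<inter> E_star k)"
proof -
  let ?l = "std_e last_index"
  have sub: "E_less k \<subseteq> E_star k"
    unfolding E_star_eq by (auto intro!: exI[of _ 0])
  have star: "vec.subspace (E_star k)" by (simp add: E_star_def)
  have "in_sum ?l k S \<longleftrightarrow> S \<inter> E_less k \<noteq> S \<inter> E_star k"
  proof
    assume "in_sum ?l k S"
    then obtain x where x: "x \<in> E_less k" "?l - x \<in> S" by (auto simp: in_sum_def)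
    have "?l - x \<in> E_star k"
      unfolding E_star_eq using x(1) vec.subspace_neg[OF subspace_E_less] by (auto intro!: exI[of _ 1])
    moreover have "?l - x \<notin> E_less k"
      using x(1) le_last_index[of k] by (auto simp: E_less_def std_e_def axis_def)
    ultimately show "S \<inter> E_less k \<noteq> S \<inter> E_star k" using x by blast
  next
    assume "S \<inter> E_less k \<noteq> S \<inter> E_star k"
    then obtain y c where y: "y \<in> S" "y \<notin> E_less k" "y - c *s ?l \<in> E_less k"
      using sub by (auto simp: E_star_eq)
    have c: "c \<noteq> 0" using y by auto
    let ?x = "- (inverse c *s (y - c *s ?l))"
    have "?x \<in> E_less k"
      by (intro vec.subspace_neg[OF subspace_E_less] vec.subspace_scale[OF subspace_E_less] y)
    moreover have "?l - ?x = inverse c *s y"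
      using c by (simp add: vec_eq_iff field_simps)
    then have "?l - ?x \<in> S" using vec.subspace_scale[OF S y(1)] by simp
    ultimately show "in_sum ?l k S" unfolding in_sum_def by blast
  qed
  also have "\<dots> \<longleftrightarrow> vec.dim (S \<inter> E_less k) \<noteq> vec.dim (S \<inter> E_star k)"
    using vec.subspace_dim_equal[OF vec.subspace_inter[OF S subspace_E_less] vec.subspace_inter[OF S star]] sub
    by (metis Int_mono order_refl)
  finally show ?thesis .
qed

lemma dim_act_Int:
  assumes "g \<in> GL" "(*v) g ` T = T"
  shows "vec.dim (act g F j \<inter> T) = vec.dim (F j \<inter> T)"
proof -
  have "act g F j \<inter> T = (*v) g ` (F j \<inter> T)"
    using assms(2) image_Int[OF GL_inj[OF assms(1)], of "F j" T] by (simp add: act_def)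
  then show ?thesis using dim_act[OF assms(1)] by simp
qed

text \<open>The only place where both orbits enter: \<open>b\<close> preserves the dimensions of the intersections with
  \<open>E_less k\<close>, and \<open>d\<close> those with \<open>E_star k\<close>.\<close>

lemma common_orbits_in_sum:
  assumes F: "F \<in> flags" and b: "b \<in> Borel" and d: "d \<in> Borel_star" and eq: "act b F = act d F"
  shows "in_sum (std_e last_index) k (act b F j) \<longleftrightarrow> in_sum (std_e last_index) k (F j)"
proof -
  have bG: "b \<in> GL" using b by (simp add: Borel_eq)
  have d': "d \<in> GL" "(*v) d ` E_star k = E_star k"
    using d by (auto simp: Borel_star_def stabilizer_def act_def fun_eq_iff)
  have "act b F \<in> flags" using F bG act_in_flags by blast
  then have "vec.subspace (F j)" "vec.subspace (act b F j)" using F by (auto simp: flags_def)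
  moreover have "vec.dim (act b F j \<inter> E_less k) = vec.dim (F j \<inter> E_less k)"
    by (rule dim_act_Int[OF bG Borel_image_E_less[OF b]])
  moreover have "vec.dim (act b F j \<inter> E_star k) = vec.dim (F j \<inter> E_star k)"
    unfolding eq by (rule dim_act_Int[OF d'])
  ultimately show ?thesis by (simp add: in_sum_last_iff_dim)
qed

text \<open>If no index in the support of \<open>m\<close> dominated \<open>a\<close>, then \<open>m\<close> would lie in a sum of a subspace of the
  standard flag and one of the coordinate flag, all of whose vectors vanish at \<open>a\<close>; the hypothesis
  puts \<open>l\<close> into the same sum.\<close>

lemma support_dominated:
  assumes w: "w \<in> Weyl" and last: "m $ last_index \<noteq> 0"
    and sum: "\<And>j k. in_sum m k (weyl_act w E_plus j) \<Longrightarrow> in_sum l k (weyl_act w E_plus j)"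
    and a: "l $ a \<noteq> 0"
  shows "\<exists>a'. a \<le> a' \<and> inv w a \<le> inv w a' \<and> m $ a' \<noteq> 0"
proof (rule ccontr)
  assume none: "\<not> ?thesis"
  \<comment> \<open>\<open>Max ?J\<close> is the smallest \<open>j\<close> that accounts for the support of \<open>m\<close> from \<open>a\<close> on. There is such
    a \<open>j\<close> because the last index is at least \<open>a\<close> and in the support.\<close>
  let ?J = "inv w ` {a'. m $ a' \<noteq> 0 \<and> a \<le> a'}"
  have "?J \<noteq> {}" using last le_last_index[of a] by blast
  then have "Max ?J \<in> ?J" by (intro Max_in) auto
  then obtain x where "Max ?J = inv w x" "m $ x \<noteq> 0" "a \<le> x" by blast
  then have less: "Max ?J < inv w a" using none by (metis not_le)
  have "a' < a \<or> inv w a' \<le> Max ?J" if "m $ a' \<noteq> 0" for a'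
    using that by (cases "a' < a") (auto intro!: Max_ge)
  then have "in_sum m a (weyl_act w E_plus (Max ?J))"
    using in_sum_weyl_act[OF w] by blast
  then have "in_sum l a (weyl_act w E_plus (Max ?J))" by (rule sum)
  then have "inv w a \<le> Max ?J" using a in_sum_weyl_act[OF w] by blast
  with less show False by simp
qed

text \<open>A flag in the \<open>Borel\<close>-orbit and in the \<open>Borel_star\<close>-orbit of \<open>F\<close> is in its \<open>Borel_pred\<close>-orbit.
  The matrix \<open>b\<close> carries \<open>F\<close> to the other flag but moves the last basis vector; precomposing it with a
  suitable element of the common stabilizer of \<open>E_plus\<close> and \<open>F\<close> repairs this.\<close>

lemma Borel_pred_transitive:
  fixes F :: "'n::{finite,linorder} chain"
  assumes F: "F \<in> flags" and b: "b \<in> Borel" and d: "d \<in> Borel_star" and eq: "act b F = act d F"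
  shows "act b F \<in> orbit Borel_pred F"
proof -
  let ?e = "std_e last_index :: 'n cvec"
  obtain w where w: "w \<in> Weyl" and "F \<in> orbit Borel (weyl_act w E_plus)"
    using Bruhat_exists[OF F] by blast
  then obtain a where a: "a \<in> Borel" and Fa: "F = act a (weyl_act w E_plus)"
    by (auto simp: mem_orbit_iff)
  obtain a' where a': "a' \<in> Borel" "a ** a' = mat 1" "a' ** a = mat 1"
    using a stabilizer_inverse unfolding Borel_def by metis
  obtain b' where b': "b' \<in> Borel" "b ** b' = mat 1" "b' ** b = mat 1"
    using b stabilizer_inverse unfolding Borel_def by metis
  \<comment> \<open>The last basis vector and its preimage under \<open>b\<close>, in the coordinates in which \<open>F\<close> is the
    coordinate flag of \<open>w\<close>.\<close>
  define l where "l = a' *v ?e"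
  define m where "m = a' *v (b' *v ?e)"
  have al: "a *v l = ?e" by (simp add: l_def matrix_vector_mul_assoc a')
  have bam: "b *v (a *v m) = ?e"
    by (simp add: m_def matrix_vector_mul_assoc a' b' matrix_mul_assoc)
  have "in_sum m k (weyl_act w E_plus j) \<longleftrightarrow> in_sum ?e k (act b F j)" for j k
    unfolding bam[symmetric] Fa by (simp add: in_sum_act a b)
  moreover have "in_sum l k (weyl_act w E_plus j) \<longleftrightarrow> in_sum ?e k (F j)" for j k
    unfolding al[symmetric] Fa by (simp add: in_sum_act a)
  ultimately have lm: "in_sum m k (weyl_act w E_plus j) \<longleftrightarrow> in_sum l k (weyl_act w E_plus j)" for j k
    using common_orbits_in_sum[OF F b d eq] by simp
  have "pivot ?e last_index" by (auto simp: pivot_def std_e_def axis_def)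
  then have "pivot l last_index" "pivot m last_index"
    by (simp_all add: l_def m_def pivot_Borel a' b')
  then have last: "l $ last_index \<noteq> 0" "m $ last_index \<noteq> 0" by (auto simp: pivot_def)
  obtain c where c: "c \<in> Borel" "c *v l = m" and cw: "\<And>i j. c $ i $ j \<noteq> 0 \<Longrightarrow> inv w i \<le> inv w j"
    using triangular_transport[of l "inv w" m] support_dominated[OF w last(2), of l]
      support_dominated[OF w last(1), of m] lm by metis
  have cX: "act c (weyl_act w E_plus) = weyl_act w E_plus"
  proof (rule act_eqI)
    fix j x assume x: "x \<in> weyl_act w E_plus j"
    have "inv w i \<le> j" if i: "(c *v x) $ i \<noteq> 0" for i
    proof -
      obtain k where "c $ i $ k * x $ k \<noteq> 0"
        using i unfolding matrix_vector_mult_def vec_lambda_beta by (meson sum.not_neutral_contains_not_neutral)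
      then have "inv w i \<le> inv w k" "inv w k \<le> j"
        using cw x mem_weyl_act_E_plus[OF w] by auto
      then show ?thesis by simp
    qed
    then show "c *v x \<in> weyl_act w E_plus j" using mem_weyl_act_E_plus[OF w] by blast
  qed (use c w in \<open>auto simp: Borel_eq weyl_act_in_flags E_plus_in_flags\<close>)
  \<comment> \<open>\<open>a ** c ** a'\<close> is \<open>c\<close> in the original coordinates: it fixes \<open>F\<close> and carries the last basis
    vector to its preimage under \<open>b\<close>.\<close>
  define h where "h = b ** (a ** (c ** a'))"
  have hB: "h \<in> Borel"
    using a a' b c unfolding h_def Borel_def by (intro stabilizer_mult)
  have he: "h *v ?e = ?e"
  proof -
    have "h *v ?e = b *v (a *v (c *v (a' *v ?e)))" by (simp add: h_def matrix_vector_mul_assoc matrix_mul_assoc)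
    then show ?thesis using c(2) bam by (simp add: l_def)
  qed
  have col: "h $ i $ last_index = (if i = last_index then 1 else 0)" for i
    using he mult_std_e[of h last_index i] by (simp add: std_e_def axis_def)
  have "h \<in> Borel_pred"
    using hB col le_last_index by (auto simp: Borel_pred_def GL_pred_def Borel_eq upper_triangular_def order_less_le)
  moreover have "act h F = act b F"
  proof -
    have "act a' F = act (a' ** a) (weyl_act w E_plus)" unfolding Fa by (simp only: act_mult)
    then have "act a' F = weyl_act w E_plus" by (simp add: a')
    then show ?thesis by (simp add: h_def act_mult cX Fa)
  qed
  ultimately show ?thesis unfolding mem_orbit_iff by metis
qed

section \<open>The map to pairs of Weyl group elements\<close>

lemma Borel_pred_subset_Borel: "Borel_pred \<subseteq> Borel"
  by (auto simp: Borel_pred_def GL_pred_def Borel_eq)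

lemma Borel_pred_subset_Borel_star: "Borel_pred \<subseteq> Borel_star"
proof
  fix g :: "'a cmat" assume g: "g \<in> Borel_pred"
  have "act g E_star = E_star"
  proof (rule act_eqI)
    fix j x assume x: "x \<in> (E_star :: 'a chain) j"
    have "g $ i $ k * x $ k = 0" if "i \<noteq> last_index" "\<not> i < j" for i k
    proof -
      consider "k = last_index" | "k < i" | "i \<le> k" "k \<noteq> last_index" by force
      then show ?thesis
      proof cases
        case 3
        then have "\<not> k < j" using that by auto
        then show ?thesis using x 3 unfolding E_star_def image_insert[symmetric] span_std_e by auto
      qed (use g that in \<open>auto simp: Borel_pred_def GL_pred_def upper_triangular_def\<close>)
    qed
    then show "g *v x \<in> E_star j"
      unfolding E_star_def image_insert[symmetric] span_std_e
      by (auto simp: matrix_vector_mult_def intro!: sum.neutral)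
  qed (use g in \<open>auto simp: Borel_pred_def GL_pred_def E_star_in_flags\<close>)
  then show "g \<in> Borel_star"
    using g by (auto simp: Borel_star_def stabilizer_def Borel_pred_def GL_pred_def)
qed

lemma one_in_Borel_pred: "mat 1 \<in> Borel_pred"
proof -
  have "mat 1 \<in> GL" using stabilizer_one by (auto simp: stabilizer_def)
  then show ?thesis by (auto simp: Borel_pred_def GL_pred_def upper_triangular_def mat_def)
qed

lemma Sh_orbit_iff:
  fixes F :: "'n::{finite,linorder} chain"
  assumes "F \<in> flags"
  shows "Sh (orbit Borel_pred F) = (w, u) \<longleftrightarrow> w \<in> Weyl \<and> u \<in> Weyl \<and>
    F \<in> orbit Borel (weyl_act w E_plus) \<and> F \<in> orbit Borel_star (weyl_act u E_star)"
proof -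
  note plus = translates_orbit_eq_iff[OF Borel_pred_subset_Borel[unfolded Borel_def] one_in_Borel_pred, folded Borel_def]
  note star = translates_orbit_eq_iff[OF Borel_pred_subset_Borel_star[unfolded Borel_star_def] one_in_Borel_pred, folded Borel_star_def]
  have "Sh (orbit Borel_pred F) =
      (THE w. w \<in> Weyl \<and> F \<in> orbit Borel (weyl_act w E_plus),
       THE u. u \<in> Weyl \<and> F \<in> orbit Borel_star (weyl_act u E_star))"
    by (simp only: Sh_def plus star)
  moreover have "(THE w. w \<in> Weyl \<and> F \<in> orbit Borel (weyl_act w E_plus)) = w \<longleftrightarrow>
      w \<in> Weyl \<and> F \<in> orbit Borel (weyl_act w E_plus)"
    using the1_equality[OF Bruhat[OF assms]] theI'[OF Bruhat[OF assms]] by blast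
  moreover have "(THE u. u \<in> Weyl \<and> F \<in> orbit Borel_star (weyl_act u E_star)) = u \<longleftrightarrow>
      u \<in> Weyl \<and> F \<in> orbit Borel_star (weyl_act u E_star)"
    using the1_equality[OF Bruhat_star[OF assms]] theI'[OF Bruhat_star[OF assms]] by blast
  ultimately show ?thesis
    by (simp only: prod.inject) blast
qed

lemma orbit_eq_Int:
  fixes F :: "'n::{finite,linorder} chain"
  assumes F: "F \<in> flags" and plus: "F \<in> orbit Borel X" and star: "F \<in> orbit Borel_star Y"
  shows "orbit Borel_pred F = orbit Borel X \<inter> orbit Borel_star Y"
proof (intro equalityI subsetI IntI)
  fix F' assume "F' \<in> orbit Borel_pred F"
  then have "F' \<in> orbit Borel F" "F' \<in> orbit Borel_star F"
    using Borel_pred_subset_Borel Borel_pred_subset_Borel_star unfolding mem_orbit_iff by blast+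
  then show "F' \<in> orbit Borel X" "F' \<in> orbit Borel_star Y"
    using plus star mem_orbit_trans unfolding Borel_def Borel_star_def by blast+
next
  fix F' assume "F' \<in> orbit Borel X \<inter> orbit Borel_star Y"
  then have "F' \<in> orbit Borel F" "F' \<in> orbit Borel_star F"
    using plus star mem_orbit_trans mem_orbit_sym unfolding Borel_def Borel_star_def by blast+
  then show "F' \<in> orbit Borel_pred F"
    using Borel_pred_transitive[OF F] unfolding mem_orbit_iff[of _ Borel] mem_orbit_iff[of _ Borel_star] by metis
qed

theorem theorem1p1:
  assumes "CARD('n::{finite,linorder}) \<ge> 2"
  shows "inj_on Sh (flag_orbits (Borel_pred :: 'n cmat set)) \<and>
    (\<forall>Q \<in> flag_orbits (Borel_pred :: 'n cmat set). \<forall>w u. Sh Q = (w, u) \<longrightarrow>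
       Q = orbit Borel (weyl_act w E_plus) \<inter> orbit Borel_star (weyl_act u E_star)) \<and>
    Sh ` flag_orbits (Borel_pred :: 'n cmat set) =
      {(w, u) \<in> Weyl \<times> Weyl. orbit Borel (weyl_act w E_plus) \<inter> orbit Borel_star (weyl_act u E_star) \<noteq> {}}"
proof (intro conjI)
  show Q_eq: "\<forall>Q \<in> flag_orbits (Borel_pred :: 'n cmat set). \<forall>w u. Sh Q = (w, u) \<longrightarrow>
       Q = orbit Borel (weyl_act w E_plus) \<inter> orbit Borel_star (weyl_act u E_star)"
    using Sh_orbit_iff orbit_eq_Int unfolding flag_orbits_def by blast
  then show "inj_on Sh (flag_orbits (Borel_pred :: 'n cmat set))"
    by (intro inj_onI) (metis surj_pair)
  show "Sh ` flag_orbits (Borel_pred :: 'n cmat set) =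
      {(w, u) \<in> Weyl \<times> Weyl. orbit Borel (weyl_act w E_plus) \<inter> orbit Borel_star (weyl_act u E_star) \<noteq> {}}"
  proof (intro equalityI subsetI; clarify)
    fix Q w u assume "Q \<in> flag_orbits (Borel_pred :: 'n cmat set)" "(w, u) = Sh Q"
    then obtain F where "F \<in> flags" "Sh (orbit Borel_pred F) = (w, u)"
      by (auto simp: flag_orbits_def)
    then show "(w, u) \<in> Weyl \<times> Weyl \<and> orbit Borel (weyl_act w E_plus) \<inter> orbit Borel_star (weyl_act u E_star) \<noteq> {}"
      using Sh_orbit_iff by blast
  next
    fix w u :: "'n \<Rightarrow> 'n"
    assume w: "w \<in> Weyl" and u: "u \<in> Weyl"
      and "orbit Borel (weyl_act w E_plus) \<inter> orbit Borel_star (weyl_act u E_star) \<noteq> {}"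
    then obtain F where F: "F \<in> orbit Borel (weyl_act w E_plus)" "F \<in> orbit Borel_star (weyl_act u E_star)"
      by blast
    then have "F \<in> flags"
      using w by (auto simp: mem_orbit_iff Borel_eq act_in_flags weyl_act_in_flags E_plus_in_flags)
    then have "Sh (orbit Borel_pred F) = (w, u)" "orbit Borel_pred F \<in> flag_orbits Borel_pred"
      using F w u Sh_orbit_iff by (auto simp: flag_orbits_def)
    then show "(w, u) \<in> Sh ` flag_orbits (Borel_pred :: 'n cmat set)" by (metis image_eqI)
  qed
qed

end
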